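(* Let $p,q\in(-\infty,-1]\cup[0,\infty)$. Both of the two-sided inequalities $$\frac{2pA+(p+3)G}{(3p+1)A+2G}\,A<P<A\,\frac{2qA+(q+3)G}{(3q+1)A+2G},$$ $$\frac{2pQ+(p+3)A}{(3p+1)Q+2A}\,Q<T<Q\,\frac{2qQ+(q+3)A}{(3q+1)Q+2A}$$ hold for all $a,b>0$ with $a\ne b$ if and only if $p\in[0,p_0]$ and $q\in(-\infty,-1]\cup[9,\infty)$, where $p_0=(\pi-3)^{-1}\approx7.063$.
   Context: For $a,b>0$ with $a\ne b$: $P=P(a,b)=\dfrac{a-b}{2\arcsin\frac{a-b}{a+b}}$ and $T=T(a,b)=\dfrac{a-b}{2\arctan\frac{a-b}{a+b}}$ are the first and second Seiffert means; $A=\frac{a+b}{2}$, $G=\sqrt{ab}$ and $Q=\sqrt{\frac{a^2+b^2}{2}}$ are the arithmetic, geometric and quadratic means. The phrase "both hold" means the conjunction of the two displayed two-sided inequalities. *)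

theory Defs
  imports Complex_Main
begin

(* The Seiffert means are only meaningful for positive arguments a \<noteq> b;
   at a = b the formulas below give the value 0 (division by zero). *)

definition seiffert_P :: "real \<Rightarrow> real \<Rightarrow> real" where
  "seiffert_P a b = (a - b) / (2 * arcsin ((a - b) / (a + b)))"

definition seiffert_T :: "real \<Rightarrow> real \<Rightarrow> real" where
  "seiffert_T a b = (a - b) / (2 * arctan ((a - b) / (a + b)))"

definition arith_mean :: "real \<Rightarrow> real \<Rightarrow> real" where
  "arith_mean a b = (a + b) / 2"

definition geom_mean :: "real \<Rightarrow> real \<Rightarrow> real" where
  "geom_mean a b = sqrt (a * b)"

definition quad_mean :: "real \<Rightarrow> real \<Rightarrow> real" where
  "quad_mean a b = sqrt ((a\<^sup>2 + b\<^sup>2) / 2)"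

end

theory Submission
  imports Defs "HOL-Analysis.Complex_Transcendental"
begin

text \<open>
  Put \<open>v = (a - b) / (a + b)\<close>. With \<open>v = sin x\<close> one has \<open>G = A cos x\<close> and \<open>P = A sin x / x\<close>;
  with \<open>v = tan x\<close> one has \<open>A = Q cos x\<close> and \<open>T = Q sin x / x\<close>. Both pairs of inequalities
  therefore become
  \<open>F\<^sub>p (cos x) < sin x / x < F\<^sub>q (cos x)\<close>, where
  \<open>F\<^sub>p c = (2p + (p + 3) c) / (3p + 1 + 2c)\<close>; the first one for all \<open>0 < \<bar>x\<bar> < \<pi>/2\<close>, the second
  one on the smaller range \<open>0 < \<bar>x\<bar> < \<pi>/4\<close>. So only the inequality on \<open>(0, \<pi>/2)\<close> matters
  (\<open>seiffert_bounds_iff\<close>).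

  For \<open>p \<ge> 0\<close> the comparison of \<open>F\<^sub>p (cos x)\<close> with \<open>sin x / x\<close> is read off from the sign of
  \<open>g\<^sub>p x = sin x / F\<^sub>p (cos x) - x\<close>, whose derivative is a positive multiple of
  \<open>2 (p + 3) cos x - (p\<^sup>2 - 6p - 3)\<close>. Since the cosine decreases, \<open>g\<^sub>p\<close> first increases and then
  decreases (one phase may be empty), starting from \<open>g\<^sub>p 0 = 0\<close>. This settles every case:
  for \<open>p \<ge> 9\<close> there is no increasing phase, hence \<open>g\<^sub>p < 0\<close>;
  for \<open>0 \<le> p < 9\<close> there is one, hence \<open>g\<^sub>p > 0\<close> near \<open>0\<close>;
  and \<open>g\<^sub>p > 0\<close> on the whole interval if \<open>p = 0\<close>, where \<open>g\<^sub>p\<close> only increases, or if the end value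
  \<open>g\<^sub>p (\<pi>/2) = (3p + 1) / (2p) - \<pi>/2\<close> is nonnegative, that is, \<open>p (\<pi> - 3) \<le> 1\<close>. If the end value
  is negative, the lower bound fails near \<open>\<pi>/2\<close>. Finally, for \<open>p \<le> -1\<close> one has
  \<open>F\<^sub>p > F\<^sub>9\<close>, so such \<open>p\<close> behave like parameters above \<open>9\<close>.
\<close>

section \<open>Sign of the gap between the bound and the sinc function\<close>

text \<open>
  The quotient \<open>F\<^sub>p c\<close>: each bound is the larger of the two means involved times this
  function of their ratio \<open>c\<close>.
\<close>

definition bound_ratio :: "real \<Rightarrow> real \<Rightarrow> real" where
  "bound_ratio p c = (2 * p + (p + 3) * c) / ((3 * p + 1) + 2 * c)"

definition bound_gap :: "real \<Rightarrow> real \<Rightarrow> real" where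
  "bound_gap p x = sin x * (3 * p + 1 + 2 * cos x) / (2 * p + (p + 3) * cos x) - x"

lemma bound_ratio_homogeneous:
  assumes "M \<noteq> 0"
  shows "(2 * p * M + (p + 3) * (M * c)) / ((3 * p + 1) * M + 2 * (M * c)) = bound_ratio p c"
proof -
  have "(2 * p * M + (p + 3) * (M * c)) / ((3 * p + 1) * M + 2 * (M * c))
      = (M * (2 * p + (p + 3) * c)) / (M * ((3 * p + 1) + 2 * c))"
    by (simp add: algebra_simps)
  then show ?thesis
    using assms by (simp add: bound_ratio_def)
qed

lemma bound_ratio_numerator_pos:
  fixes p c :: real
  assumes "p \<ge> 0" "c \<ge> 0" "p > 0 \<or> c > 0"
  shows "2 * p + (p + 3) * c > 0"
proof (cases "p > 0")
  case True
  then show ?thesis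
    using assms by (simp add: add_pos_nonneg)
next
  case False
  then show ?thesis
    using assms by (auto intro: add_nonneg_pos)
qed

lemma bound_gap_sign:
  assumes "p \<ge> 0" "0 < x" "x < pi / 2"
  shows "bound_ratio p (cos x) < sin x / x \<longleftrightarrow> bound_gap p x > 0"
    and "sin x / x < bound_ratio p (cos x) \<longleftrightarrow> bound_gap p x < 0"
proof -
  have c: "cos x > 0"
    using assms by (simp add: cos_gt_zero)
  have "2 * p + (p + 3) * cos x > 0" "3 * p + 1 + 2 * cos x > 0"
    using assms c bound_ratio_numerator_pos[of p "cos x"] by simp_all
  then show "bound_ratio p (cos x) < sin x / x \<longleftrightarrow> bound_gap p x > 0"
    and "sin x / x < bound_ratio p (cos x) \<longleftrightarrow> bound_gap p x < 0"
    using assms unfolding bound_ratio_def bound_gap_def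
    by (simp_all add: field_simps)
qed

text \<open>
  The numerator of the derivative is a cubic in \<open>c = cos x\<close>. It has the double root \<open>c = 1\<close>
  because \<open>F\<^sub>p (cos x) = sin x / x + O(x\<^sup>4)\<close> at \<open>x = 0\<close> for every \<open>p \<noteq> -1\<close>; the remaining linear
  factor decides the sign.
\<close>

lemma DERIV_bound_gap:
  assumes "2 * p + (p + 3) * cos x \<noteq> 0"
  shows "(bound_gap p has_real_derivative
      (1 - cos x)\<^sup>2 * (2 * (p + 3) * cos x - (p\<^sup>2 - 6 * p - 3))
        / (2 * p + (p + 3) * cos x)\<^sup>2) (at x)"
proof -
  define c s where "c = cos x" and "s = sin x"
  define D where "D = 2 * p + (p + 3) * c"
  have D: "D \<noteq> 0"
    using assms by (simp add: D_def c_def)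
  have s2: "s * s = 1 - c * c"
    using sin_squared_eq[of x] by (simp add: c_def s_def power2_eq_square)
  have "((\<lambda>x. sin x * (3 * p + 1 + 2 * cos x) / (2 * p + (p + 3) * cos x) - x)
      has_real_derivative
      ((c * (3 * p + 1 + 2 * c) - 2 * (s * s)) * D
        + (s * s) * (3 * p + 1 + 2 * c) * (p + 3)) / (D * D) - 1) (at x)"
    using assms unfolding c_def s_def D_def
    by (auto intro!: derivative_eq_intros simp: algebra_simps)
  moreover have "((c * (3 * p + 1 + 2 * c) - 2 * (s * s)) * D
        + (s * s) * (3 * p + 1 + 2 * c) * (p + 3)) / (D * D) - 1
      = ((c * (3 * p + 1 + 2 * c) - 2 * (1 - c * c)) * D
        + (1 - c * c) * (3 * p + 1 + 2 * c) * (p + 3) - D * D) / (D * D)"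
    using D by (simp add: s2 diff_divide_distrib)
  moreover have "(c * (3 * p + 1 + 2 * c) - 2 * (1 - c * c)) * D
        + (1 - c * c) * (3 * p + 1 + 2 * c) * (p + 3) - D * D
      = (1 - c)\<^sup>2 * (2 * (p + 3) * c - (p\<^sup>2 - 6 * p - 3))"
    unfolding D_def by algebra
  ultimately show ?thesis
    by (simp add: bound_gap_def[abs_def] c_def D_def power2_eq_square)
qed

lemma continuous_on_bound_gap:
  assumes "\<And>x. x \<in> S \<Longrightarrow> 2 * p + (p + 3) * cos x \<noteq> 0"
  shows "continuous_on S (bound_gap p)"
  using DERIV_bound_gap[OF assms] DERIV_isCont continuous_at_imp_continuous_on by blast

lemma bound_gap_strict_increasing:
  assumes "p \<ge> 0" "0 \<le> u" "u < v" "v < pi / 2"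
    and "2 * (p + 3) * cos v \<ge> p\<^sup>2 - 6 * p - 3"
  shows "bound_gap p u < bound_gap p v"
proof (rule DERIV_pos_imp_increasing_open[OF \<open>u < v\<close>])
  have den: "2 * p + (p + 3) * cos x > 0" if "u \<le> x" "x \<le> v" for x
    using assms that by (intro bound_ratio_numerator_pos) (auto intro!: cos_gt_zero_pi less_imp_le)
  then show "continuous_on {u..v} (bound_gap p)"
    by (intro continuous_on_bound_gap) force
  fix x assume x: "u < x" "x < v"
  have "cos x > cos v"
    using assms x by (intro cos_monotone_0_pi) auto
  then have "2 * (p + 3) * cos x > 2 * (p + 3) * cos v"
    using assms by simp
  moreover have "cos x < 1"
    using assms x cos_monotone_0_pi[of 0 x] by simp
  ultimately have "(1 - cos x)\<^sup>2 * (2 * (p + 3) * cos x - (p\<^sup>2 - 6 * p - 3))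
      / (2 * p + (p + 3) * cos x)\<^sup>2 > 0"
    using assms(5) den[of x] x by (intro divide_pos_pos mult_pos_pos) auto
  then show "\<exists>y. DERIV (bound_gap p) x :> y \<and> y > 0"
    using den[of x] x DERIV_bound_gap[of p x] by force
qed

text \<open>
  For \<open>p > 0\<close> the denominator of \<open>g\<^sub>p\<close> is still positive at \<open>\<pi>/2\<close>. The end point is included
  because the lower bound is proved by comparison with \<open>g\<^sub>p (\<pi>/2)\<close>.
\<close>

lemma bound_gap_strict_decreasing:
  assumes "p > 0" "0 \<le> u" "u < v" "v \<le> pi / 2"
    and "2 * (p + 3) * cos u \<le> p\<^sup>2 - 6 * p - 3"
  shows "bound_gap p v < bound_gap p u"
proof (rule DERIV_neg_imp_decreasing_open[OF \<open>u < v\<close>])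
  have den: "2 * p + (p + 3) * cos x > 0" if "u \<le> x" "x \<le> v" for x
    using assms that by (intro bound_ratio_numerator_pos) (auto intro!: cos_ge_zero)
  then show "continuous_on {u..v} (bound_gap p)"
    by (intro continuous_on_bound_gap) force
  fix x assume x: "u < x" "x < v"
  have "cos u > cos x"
    using assms x by (intro cos_monotone_0_pi) auto
  then have "2 * (p + 3) * cos x < 2 * (p + 3) * cos u"
    using assms by simp
  moreover have "cos x < 1"
    using assms x cos_monotone_0_pi[of 0 x] by simp
  ultimately have "(1 - cos x)\<^sup>2 * (2 * (p + 3) * cos x - (p\<^sup>2 - 6 * p - 3))
      / (2 * p + (p + 3) * cos x)\<^sup>2 < 0"
    using assms(5) den[of x] x by (intro divide_neg_pos mult_pos_neg) auto
  then show "\<exists>y. DERIV (bound_gap p) x :> y \<and> y < 0"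
    using den[of x] x DERIV_bound_gap[of p x] by force
qed

section \<open>Comparison of the bounds with the sinc function\<close>

text \<open>In its increasing phase \<open>g\<^sub>p\<close> exceeds \<open>g\<^sub>p 0 = 0\<close>.\<close>

lemma bound_ratio_less_sinc_of_increasing:
  assumes "p \<ge> 0" "0 < x" "x < pi / 2" "2 * (p + 3) * cos x \<ge> p\<^sup>2 - 6 * p - 3"
  shows "bound_ratio p (cos x) < sin x / x"
proof -
  have "bound_gap p 0 < bound_gap p x"
    using assms by (intro bound_gap_strict_increasing) auto
  then show ?thesis
    using assms by (simp add: bound_gap_sign) (simp add: bound_gap_def)
qed

text \<open>
  In its decreasing phase \<open>g\<^sub>p\<close> exceeds \<open>g\<^sub>p (\<pi>/2)\<close>, and for \<open>p > 0\<close> the hypothesis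
  \<open>p (\<pi> - 3) \<le> 1\<close> says that this end value is nonnegative.
\<close>

lemma bound_ratio_less_sinc:
  assumes "p \<ge> 0" "p * (pi - 3) \<le> 1" "0 < x" "x < pi / 2"
  shows "bound_ratio p (cos x) < sin x / x"
proof (cases "2 * (p + 3) * cos x \<ge> p\<^sup>2 - 6 * p - 3")
  case True
  then show ?thesis
    using assms by (intro bound_ratio_less_sinc_of_increasing)
next
  case False
  have "cos x > 0"
    using assms by (simp add: cos_gt_zero)
  then have "p > 0"
    using False assms by (cases "p = 0") auto
  have "0 \<le> bound_gap p (pi / 2)"
    using assms \<open>p > 0\<close> by (simp add: bound_gap_def field_simps)
  also have "\<dots> < bound_gap p x"
    using assms False \<open>p > 0\<close> by (intro bound_gap_strict_decreasing) auto
  finally show ?thesis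
    using assms by (simp add: bound_gap_sign)
qed

text \<open>
  The linear factor of the derivative at \<open>x = 0\<close> is \<open>(9 - p) (p + 1) \<le> 0\<close>, so \<open>g\<^sub>p\<close>
  decreases from the start.
\<close>

lemma sinc_less_bound_ratio_of_ge_9:
  assumes "p \<ge> 9" "0 < x" "x < pi / 2"
  shows "sin x / x < bound_ratio p (cos x)"
proof -
  have "(p - 9) * (p + 1) \<ge> 0"
    using assms by simp
  then have "2 * (p + 3) * cos 0 \<le> p\<^sup>2 - 6 * p - 3"
    by (simp add: algebra_simps power2_eq_square)
  then have "bound_gap p x < bound_gap p 0"
    using assms by (intro bound_gap_strict_decreasing) auto
  then show ?thesis
    using assms by (simp add: bound_gap_sign) (simp add: bound_gap_def)
qed

text \<open>
  As a function of \<open>p\<close>, \<open>F\<^sub>p c\<close> is a Moebius map that increases on each side of its pole, and the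
  pole lies in \<open>(-1, 0)\<close>. Passing from \<open>9\<close> through \<open>\<infinity>\<close> to \<open>(-\<infinity>, -1]\<close> it keeps increasing.
\<close>

lemma bound_ratio_9_less:
  assumes "p \<le> -1" "0 \<le> c" "c < 1"
  shows "bound_ratio 9 c < bound_ratio p c"
proof -
  have d: "3 * p + 1 + 2 * c < 0" "28 + 2 * c > 0"
    using assms by auto
  have "bound_ratio p c - bound_ratio 9 c
      = 2 * (1 - c)\<^sup>2 * (p - 9) / ((3 * p + 1 + 2 * c) * (28 + 2 * c))"
  proof -
    have "bound_ratio p c - bound_ratio 9 c
        = ((2 * p + (p + 3) * c) * (28 + 2 * c) - (18 + 12 * c) * (3 * p + 1 + 2 * c))
          / ((3 * p + 1 + 2 * c) * (28 + 2 * c))"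
      using d by (simp add: bound_ratio_def diff_frac_eq)
    moreover have "(2 * p + (p + 3) * c) * (28 + 2 * c) - (18 + 12 * c) * (3 * p + 1 + 2 * c)
        = 2 * (1 - c)\<^sup>2 * (p - 9)"
      by algebra
    ultimately show ?thesis
      by simp
  qed
  also have "\<dots> > 0"
    using assms d by (intro divide_neg_neg mult_pos_neg mult_neg_pos) auto
  finally show ?thesis
    by simp
qed

lemma sinc_less_bound_ratio:
  assumes "p \<in> {..-1} \<union> {9..}" "0 < x" "x < pi / 2"
  shows "sin x / x < bound_ratio p (cos x)"
proof (cases "p \<ge> 9")
  case True
  then show ?thesis
    using assms by (intro sinc_less_bound_ratio_of_ge_9)
next
  case False
  have "sin x / x < bound_ratio 9 (cos x)"
    using assms by (intro sinc_less_bound_ratio_of_ge_9) auto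
  also have "\<dots> < bound_ratio p (cos x)"
    using assms False cos_gt_zero[of x] cos_monotone_0_pi[of 0 x]
    by (intro bound_ratio_9_less) auto
  finally show ?thesis .
qed

text \<open>
  At \<open>\<pi>/2\<close> the bound \<open>F\<^sub>p (cos x) \<le> sin x / x\<close> reads \<open>2p / (3p + 1) \<le> 2 / \<pi>\<close>, so a failure there
  spreads to nearby points by continuity.
\<close>

lemma bound_ratio_less_sinc_imp:
  assumes "p \<ge> 0" and less: "\<And>x. 0 < x \<Longrightarrow> x < pi / 2 \<Longrightarrow> bound_ratio p (cos x) < sin x / x"
  shows "p * (pi - 3) \<le> 1"
proof -
  have "((\<lambda>x. sin x / x - bound_ratio p (cos x)) \<longlongrightarrow>
      sin (pi / 2) / (pi / 2) - bound_ratio p (cos (pi / 2))) (at_left (pi / 2))"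
    unfolding bound_ratio_def using assms by (auto intro!: tendsto_eq_intros)
  moreover have "eventually (\<lambda>x. 0 \<le> sin x / x - bound_ratio p (cos x)) (at_left (pi / 2))"
    using eventually_at_left_real[of 0 "pi / 2"] pi_gt_zero
    by (auto elim!: eventually_mono dest!: less)
  ultimately have "0 \<le> sin (pi / 2) / (pi / 2) - bound_ratio p (cos (pi / 2))"
    by (intro tendsto_lowerbound[where F = "at_left (pi / 2)"]) auto
  then have "2 * p / (3 * p + 1) \<le> 2 / pi"
    by (simp add: bound_ratio_def)
  moreover have "3 * p + 1 > 0"
    using \<open>p \<ge> 0\<close> by simp
  ultimately show ?thesis
    by (simp add: divide_le_eq le_divide_eq) (simp add: algebra_simps)
qed

text \<open>
  The linear factor of the derivative at \<open>x = 0\<close> is \<open>(9 - p) (p + 1) > 0\<close>, so \<open>g\<^sub>p\<close> has an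
  increasing phase.
\<close>

lemma ex_bound_ratio_less_sinc:
  assumes "0 \<le> p" "p < 9"
  shows "\<exists>x. 0 < x \<and> x < pi / 2 \<and> bound_ratio p (cos x) < sin x / x"
proof -
  \<comment> \<open>The factor is nonnegative where the cosine is at least \<open>r\<close>.\<close>
  define r where "r = (p\<^sup>2 - 6 * p - 3) / (2 * (p + 3))"
  have "(9 - p) * (p + 1) > 0"
    using assms by simp
  then have "p\<^sup>2 - 6 * p - 3 < 2 * (p + 3)"
    by (simp add: algebra_simps power2_eq_square)
  then have "r < 1"
    using assms by (simp add: r_def)
  define c where "c = (1 + max r 0) / 2"
  have c: "0 < c" "c < 1" "r \<le> c"
    using \<open>r < 1\<close> by (auto simp: c_def)
  have x: "0 < arccos c" "arccos c < pi / 2" "cos (arccos c) = c"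
    using c arccos_less_arccos[of c 1] arccos_less_arccos[of 0 c] by auto
  have "p\<^sup>2 - 6 * p - 3 \<le> 2 * (p + 3) * cos (arccos c)"
    using c assms unfolding x(3) r_def by (simp add: field_simps)
  then show ?thesis
    using bound_ratio_less_sinc_of_increasing[of p "arccos c"] assms x by blast
qed

section \<open>Trigonometric form of the means\<close>

text \<open>
  If \<open>a < b\<close>, the substitution produces a negative angle \<open>x\<close>; replacing it by \<open>\<bar>x\<bar>\<close> changes
  neither \<open>cos x\<close> nor \<open>sin x / x\<close>.
\<close>

lemma sinc_abs: "sin \<bar>x\<bar> / \<bar>x\<bar> = sin x / (x :: real)"
  by (cases "x \<ge> 0") auto

lemma seiffert_P_param:
  assumes "a > 0" "b > 0" "a \<noteq> b"
  obtains x where "0 < x" "x < pi / 2"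
    "geom_mean a b = arith_mean a b * cos x" "seiffert_P a b = arith_mean a b * (sin x / x)"
proof -
  define v where "v = (a - b) / (a + b)"
  have v: "-1 < v" "v < 1" "v \<noteq> 0"
    using assms by (auto simp: v_def field_simps)
  define x where "x = arcsin v"
  have sx: "sin x = v" and x: "- (pi / 2) < x" "x < pi / 2"
    using v arcsin_lt_bounded[of v] by (auto simp: x_def)
  have "x \<noteq> 0"
    using sx v by auto
  have A: "arith_mean a b > 0"
    using assms by (simp add: arith_mean_def)
  have "a * b = (arith_mean a b)\<^sup>2 * (1 - v\<^sup>2)"
    using assms by (simp add: v_def arith_mean_def power_divide divide_simps)
      (simp add: power2_eq_square algebra_simps)
  also have "1 - v\<^sup>2 = (cos x)\<^sup>2"
    using sx cos_squared_eq[of x] by simp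
  finally have "a * b = (arith_mean a b * cos x)\<^sup>2"
    by (simp add: power_mult_distrib)
  then have "geom_mean a b = arith_mean a b * cos x"
    using A x cos_gt_zero_pi[of x] by (simp add: geom_mean_def)
  moreover have "seiffert_P a b = arith_mean a b * (sin x / x)"
    using assms sx unfolding seiffert_P_def arith_mean_def v_def[symmetric] x_def[symmetric]
    by (simp add: v_def)
  ultimately show ?thesis
    using x \<open>x \<noteq> 0\<close> by (intro that[of "\<bar>x\<bar>"]) (auto simp: sinc_abs)
qed

lemma seiffert_T_param:
  assumes "a > 0" "b > 0" "a \<noteq> b"
  obtains x where "0 < x" "x < pi / 2"
    "arith_mean a b = quad_mean a b * cos x" "seiffert_T a b = quad_mean a b * (sin x / x)"
proof -
  define v where "v = (a - b) / (a + b)"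
  have v: "v \<noteq> 0"
    using assms by (auto simp: v_def)
  define x where "x = arctan v"
  have tx: "tan x = v" and x: "- (pi / 2) < x" "x < pi / 2"
    using arctan_bounded[of v] by (auto simp: x_def tan_arctan)
  have c: "cos x > 0"
    using x by (intro cos_gt_zero_pi) auto
  have "x \<noteq> 0"
    using tx v by auto
  have A: "arith_mean a b > 0"
    using assms by (simp add: arith_mean_def)
  have "(a\<^sup>2 + b\<^sup>2) / 2 = (arith_mean a b)\<^sup>2 * (1 + v\<^sup>2)"
    using assms by (simp add: v_def arith_mean_def power_divide divide_simps)
      (simp add: power2_eq_square algebra_simps)
  also have "1 + v\<^sup>2 = (inverse (cos x))\<^sup>2"
    using tx tan_sec[of x] c by simp
  finally have "(a\<^sup>2 + b\<^sup>2) / 2 = (arith_mean a b * inverse (cos x))\<^sup>2"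
    by (simp add: power_mult_distrib)
  then have "quad_mean a b = arith_mean a b * inverse (cos x)"
    using A c by (simp add: quad_mean_def)
  then have Q: "arith_mean a b = quad_mean a b * cos x"
    using c by simp
  have "seiffert_T a b = arith_mean a b * (v / x)"
    using assms unfolding seiffert_T_def arith_mean_def v_def[symmetric] x_def[symmetric]
    by (simp add: v_def)
  also have "\<dots> = quad_mean a b * (sin x / x)"
    using c unfolding Q tx[symmetric] tan_def by simp
  finally show ?thesis
    using x \<open>x \<noteq> 0\<close> Q by (intro that[of "\<bar>x\<bar>"]) (auto simp: sinc_abs)
qed

text \<open>Conversely, every angle is realised by the pair \<open>1 \<plusminus> sin x\<close>, already for the first mean.\<close>

lemma seiffert_P_realize:
  assumes "0 < x" "x < pi / 2"
  shows "arith_mean (1 + sin x) (1 - sin x) = 1"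
    and "geom_mean (1 + sin x) (1 - sin x) = cos x"
    and "seiffert_P (1 + sin x) (1 - sin x) = sin x / x"
proof -
  show "arith_mean (1 + sin x) (1 - sin x) = 1"
    by (simp add: arith_mean_def)
  have "(1 + sin x) * (1 - sin x) = (cos x)\<^sup>2"
    using cos_squared_eq[of x] by (simp add: algebra_simps power2_eq_square)
  then show "geom_mean (1 + sin x) (1 - sin x) = cos x"
    using assms cos_gt_zero[of x] by (simp add: geom_mean_def)
  show "seiffert_P (1 + sin x) (1 - sin x) = sin x / x"
    using assms arcsin_sin[of x] by (simp add: seiffert_P_def)
qed

lemma seiffert_bounds_iff:
  fixes p q :: real
  shows "(\<forall>a b :: real. a > 0 \<and> b > 0 \<and> a \<noteq> b \<longrightarrow>
      (let A = arith_mean a b; G = geom_mean a b; Q = quad_mean a b;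
           P = seiffert_P a b; T = seiffert_T a b
       in ((2 * p * A + (p + 3) * G) / ((3 * p + 1) * A + 2 * G) * A < P \<and>
           P < A * ((2 * q * A + (q + 3) * G) / ((3 * q + 1) * A + 2 * G))) \<and>
          ((2 * p * Q + (p + 3) * A) / ((3 * p + 1) * Q + 2 * A) * Q < T \<and>
           T < Q * ((2 * q * Q + (q + 3) * A) / ((3 * q + 1) * Q + 2 * A)))))
    \<longleftrightarrow> (\<forall>x. 0 < x \<and> x < pi / 2 \<longrightarrow>
          bound_ratio p (cos x) < sin x / x \<and> sin x / x < bound_ratio q (cos x))"
    (is "?means \<longleftrightarrow> ?angles")
proof
  assume means: ?means
  show ?angles
  proof (intro allI impI)
    fix x :: real assume "0 < x \<and> x < pi / 2"
    then have x: "0 < x" "x < pi / 2"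
      by auto
    have "0 < sin x" "sin x < 1"
      using x sin_gt_zero[of x] sin_monotone_2pi[of x "pi / 2"] by auto
    then have ab: "1 + sin x > 0" "1 - sin x > 0" "1 + sin x \<noteq> 1 - sin x"
      by auto
    show "bound_ratio p (cos x) < sin x / x \<and> sin x / x < bound_ratio q (cos x)"
      using means[rule_format, of "1 + sin x" "1 - sin x"] ab
      unfolding Let_def seiffert_P_realize[OF x] by (simp add: bound_ratio_def)
  qed
next
  assume angles: ?angles
  have bounds: "(2 * p * M + (p + 3) * (M * cos x)) / ((3 * p + 1) * M + 2 * (M * cos x)) * M
        < M * (sin x / x) \<and>
      M * (sin x / x)
        < M * ((2 * q * M + (q + 3) * (M * cos x)) / ((3 * q + 1) * M + 2 * (M * cos x)))"
    if "M > 0" "0 < x" "x < pi / 2" for M x :: real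
  proof -
    have "bound_ratio p (cos x) < sin x / x" "sin x / x < bound_ratio q (cos x)"
      using angles that by auto
    then have "M * bound_ratio p (cos x) < M * (sin x / x)"
      "M * (sin x / x) < M * bound_ratio q (cos x)"
      using \<open>M > 0\<close> by (simp_all only: mult_less_cancel_left_pos)
    moreover have "M \<noteq> 0"
      using \<open>M > 0\<close> by simp
    ultimately show ?thesis
      by (simp only: bound_ratio_homogeneous mult.commute[of "bound_ratio p (cos x)"] simp_thms)
  qed
  show ?means
  proof (intro allI impI)
    fix a b :: real assume "a > 0 \<and> b > 0 \<and> a \<noteq> b"
    then have ab: "a > 0" "b > 0" "a \<noteq> b"
      by auto
    have A: "arith_mean a b > 0"
      using ab by (simp add: arith_mean_def)
    have Q: "quad_mean a b > 0"
      using ab by (simp add: quad_mean_def add_pos_pos)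
    obtain x where x: "0 < x" "x < pi / 2" "geom_mean a b = arith_mean a b * cos x"
      "seiffert_P a b = arith_mean a b * (sin x / x)"
      using seiffert_P_param[OF ab] .
    obtain y where y: "0 < y" "y < pi / 2" "arith_mean a b = quad_mean a b * cos y"
      "seiffert_T a b = quad_mean a b * (sin y / y)"
      using seiffert_T_param[OF ab] .
    show "let A = arith_mean a b; G = geom_mean a b; Q = quad_mean a b;
           P = seiffert_P a b; T = seiffert_T a b
       in ((2 * p * A + (p + 3) * G) / ((3 * p + 1) * A + 2 * G) * A < P \<and>
           P < A * ((2 * q * A + (q + 3) * G) / ((3 * q + 1) * A + 2 * G))) \<and>
          ((2 * p * Q + (p + 3) * A) / ((3 * p + 1) * Q + 2 * A) * Q < T \<and>
           T < Q * ((2 * q * Q + (q + 3) * A) / ((3 * q + 1) * Q + 2 * A)))"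
      unfolding Let_def
      using bounds[OF A x(1,2), folded x(3,4)] bounds[OF Q y(1,2), folded y(3,4)] by blast
  qed
qed

section \<open>The sharp parameter ranges\<close>

theorem proposition4:
  fixes p q :: real
  assumes "p \<in> {..-1} \<union> {0..}" and "q \<in> {..-1} \<union> {0..}"
  shows "(\<forall>a b :: real. a > 0 \<and> b > 0 \<and> a \<noteq> b \<longrightarrow>
      (let A = arith_mean a b; G = geom_mean a b; Q = quad_mean a b;
           P = seiffert_P a b; T = seiffert_T a b
       in ((2 * p * A + (p + 3) * G) / ((3 * p + 1) * A + 2 * G) * A < P \<and>
           P < A * ((2 * q * A + (q + 3) * G) / ((3 * q + 1) * A + 2 * G))) \<and>
          ((2 * p * Q + (p + 3) * A) / ((3 * p + 1) * Q + 2 * A) * Q < T \<and>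
           T < Q * ((2 * q * Q + (q + 3) * A) / ((3 * q + 1) * Q + 2 * A)))))
    \<longleftrightarrow> p \<in> {0..inverse (pi - 3)} \<and> q \<in> {..-1} \<union> {9..}"
proof -
  have threshold: "p \<le> inverse (pi - 3) \<longleftrightarrow> p * (pi - 3) \<le> 1"
    using pi_gt3 by (simp add: field_simps)
  show ?thesis
    unfolding seiffert_bounds_iff
  proof (intro iffI conjI allI impI; (elim conjE)?)
    assume *: "\<forall>x. 0 < x \<and> x < pi / 2 \<longrightarrow>
        bound_ratio p (cos x) < sin x / x \<and> sin x / x < bound_ratio q (cos x)"
    have "p \<ge> 0"
    proof (rule ccontr)
      assume "\<not> p \<ge> 0"
      then have "p \<in> {..-1} \<union> {9..}"
        using assms by auto
      then have "sin 1 / 1 < bound_ratio p (cos 1)"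
        using pi_gt3 by (intro sinc_less_bound_ratio) auto
      moreover have "bound_ratio p (cos 1) < sin 1 / 1"
        using * pi_gt3 by (auto dest!: spec[of _ 1])
      ultimately show False
        by simp
    qed
    moreover have "p * (pi - 3) \<le> 1"
      using * \<open>p \<ge> 0\<close> by (intro bound_ratio_less_sinc_imp) auto
    ultimately show "p \<in> {0..inverse (pi - 3)}"
      using threshold by simp
    show "q \<in> {..-1} \<union> {9..}"
    proof (rule ccontr)
      assume "q \<notin> {..-1} \<union> {9..}"
      then have "0 \<le> q" "q < 9"
        using assms by auto
      then obtain x where "0 < x" "x < pi / 2" "bound_ratio q (cos x) < sin x / x"
        using ex_bound_ratio_less_sinc by blast
      then show False
        using * by force
    qed
  next
    fix x :: real
    assume "p \<in> {0..inverse (pi - 3)}" "0 < x" "x < pi / 2"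
    then show "bound_ratio p (cos x) < sin x / x"
      using threshold by (intro bound_ratio_less_sinc) auto
  next
    fix x :: real
    assume "q \<in> {..-1} \<union> {9..}" "0 < x" "x < pi / 2"
    then show "sin x / x < bound_ratio q (cos x)"
      by (rule sinc_less_bound_ratio)
  qed
qed

end
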